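(* Let $\mathcal{A}$ be a finite set and let $E\in\mathbb{R}_{\ge0}^{\mathcal{A}\times\mathcal{A}}$ satisfy $E=E^T$, $\sum_{a\in\mathcal{A}}E_{a,b}>0$ for every $b\in\mathcal{A}$, and $\sum_{b\in\mathcal{A}}E_{a,b}>0$ for every $a\in\mathcal{A}$. For $d\in\mathbb{N}$ let $\mathcal{G}^{(d)}$ be the free group with $d$ generators and let $Y_E^{(d)}$ be the Markov shift space over $\mathcal{G}^{(d)}$ determined by $E$. Then the entropy $h(Y_E^{(d)})$ is increasing in $d$.
   Context: "Increasing" means non-decreasing. With $s_1,\dots,s_d$ free generators of $\mathcal{G}^{(d)}$, the Markov shift space is $Y_E^{(d)}=\{x\in\mathcal{A}^{\mathcal{G}^{(d)}}: E_{x_{gs_i},x_g}>0\ \ \forall g\in\mathcal{G}^{(d)},\ 1\le i\le d\}$. Its entropy is $h(Y_E^{(d)})=\lim_{n\to\infty}\frac{\log|\{x|_{B_n}:x\in Y_E^{(d)}\}|}{|B_n|}$, where $B_n$ is the set of elements of $\mathcal{G}^{(d)}$ of word length at most $n$ with respect to $s_1^{\pm1},\dots,s_d^{\pm1}$ (the limit exists). *)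

theory Defs
  imports Complex_Main "HOL-Algebra.Group" "HOL-Library.FuncSet"
begin

text \<open>
  The free group on \<open>s\<^sub>1, \<dots>, s\<^sub>d\<close> is realised by reduced words:
  the letter \<open>(i, True)\<close> stands for \<open>s\<^sub>i\<close> and \<open>(i, False)\<close> for its inverse.
\<close>

type_synonym letter = "nat \<times> bool"

fun letter_inv :: "letter \<Rightarrow> letter" where
  "letter_inv (i, e) = (i, \<not> e)"

fun reduced :: "letter list \<Rightarrow> bool" where
  "reduced [] \<longleftrightarrow> True"
| "reduced [l] \<longleftrightarrow> True"
| "reduced (l # m # w) \<longleftrightarrow> m \<noteq> letter_inv l \<and> reduced (m # w)"

text \<open>Multiplication of a reduced word by a letter from the left.\<close>

fun push :: "letter \<Rightarrow> letter list \<Rightarrow> letter list" where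
  "push l [] = [l]"
| "push l (m # w) = (if m = letter_inv l then w else l # m # w)"

definition free_group :: "nat \<Rightarrow> letter list monoid" where
  "free_group d =
     \<lparr>carrier = {w. reduced w \<and> fst ` set w \<subseteq> {1..d}},
      mult = foldr push,
      one = []\<rparr>"

definition free_gen :: "nat \<Rightarrow> letter list" where
  "free_gen i = [(i, True)]"

definition word_ball :: "nat \<Rightarrow> nat \<Rightarrow> letter list set" where
  "word_ball d n =
     {foldr (\<lambda>u v. u \<otimes>\<^bsub>free_group d\<^esub> v) us \<one>\<^bsub>free_group d\<^esub> | us.
        length us \<le> n \<and>
        set us \<subseteq> free_gen ` {1..d} \<union> (\<lambda>i. inv\<^bsub>free_group d\<^esub> (free_gen i)) ` {1..d}}"

definition markov_shift :: "nat \<Rightarrow> 'a set \<Rightarrow> ('a \<Rightarrow> 'a \<Rightarrow> real) \<Rightarrow> (letter list \<Rightarrow> 'a) set" where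
  "markov_shift d A E =
     {x \<in> carrier (free_group d) \<rightarrow>\<^sub>E A.
        \<forall>g \<in> carrier (free_group d). \<forall>i \<in> {1..d}.
          E (x (g \<otimes>\<^bsub>free_group d\<^esub> free_gen i)) (x g) > 0}"

definition ball_patterns :: "nat \<Rightarrow> (letter list \<Rightarrow> 'a) set \<Rightarrow> nat \<Rightarrow> (letter list \<Rightarrow> 'a) set" where
  "ball_patterns d Y n = (\<lambda>x. restrict x (word_ball d n)) ` Y"

text \<open>
  Natural logarithm. For \<open>Y = {}\<close> all pattern counts are \<open>0\<close>, and \<open>ln 0 = 0\<close>
  makes the entropy \<open>0\<close> rather than \<open>-\<infinity>\<close>.
\<close>

definition shift_entropy :: "nat \<Rightarrow> (letter list \<Rightarrow> 'a) set \<Rightarrow> real" where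
  "shift_entropy d Y =
     lim (\<lambda>n. ln (real (card (ball_patterns d Y n))) / real (card (word_ball d n)))"

lemma letter_inv_inv [simp]: "letter_inv (letter_inv l) = l"
  by (cases l) simp

lemma letter_inv_neq [simp]: "letter_inv l \<noteq> l"
  by (cases l) simp

lemma fst_letter_inv [simp]: "fst (letter_inv l) = fst l"
  by (cases l) simp

lemma reduced_tl: "reduced (l # w) \<Longrightarrow> reduced w"
  by (cases w) auto

lemma reduced_push: "reduced w \<Longrightarrow> reduced (push l w)"
  by (cases w) (auto dest: reduced_tl)

lemma set_push: "set (push l w) \<subseteq> insert l (set w)"
  by (cases w) auto

lemma push_push: "reduced w \<Longrightarrow> push l (push (letter_inv l) w) = w"
  by (cases w rule: reduced.cases) auto

lemma reduced_foldr_push: "reduced w \<Longrightarrow> reduced (foldr push u w)"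
  by (induction u) (auto intro: reduced_push)

lemma set_foldr_push: "set (foldr push u w) \<subseteq> set u \<union> set w"
proof (induction u)
  case (Cons l u)
  then show ?case using set_push[of l "foldr push u w"] by auto
qed simp

lemma push_reduced: "reduced (l # w) \<Longrightarrow> push l w = l # w"
  by (cases w) auto

lemma foldr_push_Nil: "reduced w \<Longrightarrow> foldr push w [] = w"
proof (induction w)
  case (Cons l w)
  then show ?case using reduced_tl[of l w] push_reduced[of l w] by simp
qed simp

lemma foldr_push_push:
  assumes "reduced w"
  shows "foldr push (push l v) w = push l (foldr push v w)"
proof (cases v)
  case (Cons m v')
  have "push l (push (letter_inv l) (foldr push v' w)) = foldr push v' w"
    using assms by (intro push_push reduced_foldr_push)
  then show ?thesis using Cons by auto
qed simp

lemma foldr_push_assoc: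
  assumes "reduced w"
  shows "foldr push (foldr push u v) w = foldr push u (foldr push v w)"
  by (induction u) (simp_all add: foldr_push_push assms)

lemma foldr_push_inverse:
  "reduced v \<Longrightarrow> foldr push (map letter_inv (rev w)) (foldr push w v) = v"
proof (induction w)
  case (Cons l w)
  have "push (letter_inv l) (push l (foldr push w v)) = foldr push w v"
    using push_push[of "foldr push w v" "letter_inv l"] reduced_foldr_push[OF Cons.prems] by simp
  then show ?case using Cons by simp
qed simp

lemma group_free_group: "group (free_group d)"
proof (rule groupI)
  fix x assume x: "x \<in> carrier (free_group d)"
  let ?y = "foldr push (map letter_inv (rev x)) []"
  have "foldr push ?y x = foldr push (map letter_inv (rev x)) (foldr push x [])"
    using x by (simp add: free_group_def foldr_push_assoc foldr_push_Nil)
  then have "foldr push ?y x = []"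
    using foldr_push_inverse[of "[]" x] by simp
  moreover have "?y \<in> carrier (free_group d)"
  proof -
    have "fst ` set ?y \<subseteq> fst ` set (map letter_inv (rev x))"
      using set_foldr_push[of "map letter_inv (rev x)" "[]"] by (simp add: image_mono)
    also have "\<dots> = fst ` set x" by (auto simp: image_image)
    finally show ?thesis using x by (auto simp: free_group_def reduced_foldr_push)
  qed
  ultimately show "\<exists>y\<in>carrier (free_group d). y \<otimes>\<^bsub>free_group d\<^esub> x = \<one>\<^bsub>free_group d\<^esub>"
    by (intro bexI[of _ ?y]) (simp_all add: free_group_def)
next
  fix x y assume "x \<in> carrier (free_group d)" "y \<in> carrier (free_group d)"
  then show "x \<otimes>\<^bsub>free_group d\<^esub> y \<in> carrier (free_group d)"
    using order_trans[OF image_mono[OF set_foldr_push[of x y], of fst], of "{1..d}"]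
    by (simp add: free_group_def reduced_foldr_push image_Un)
qed (auto simp: free_group_def foldr_push_assoc)

text \<open>Universal property: \<open>free_group d\<close> is free on \<open>free_gen 1, \<dots>, free_gen d\<close>.\<close>

lemma free_gen_carrier: "i \<in> {1..d} \<Longrightarrow> free_gen i \<in> carrier (free_group d)"
  by (simp add: free_group_def free_gen_def)

lemma inv_free_gen: "i \<in> {1..d} \<Longrightarrow> inv\<^bsub>free_group d\<^esub> (free_gen i) = [(i, False)]"
  by (intro group.inv_equality[OF group_free_group] free_gen_carrier)
     (simp_all add: free_group_def free_gen_def)

theorem free_group_universal:
  fixes H (structure)
  assumes H: "group H" and f: "f \<in> {1..d} \<rightarrow> carrier H"
  shows "\<exists>h \<in> hom (free_group d) H. (\<forall>i\<in>{1..d}. h (free_gen i) = f i) \<and>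
           (\<forall>h' \<in> hom (free_group d) H. (\<forall>i\<in>{1..d}. h' (free_gen i) = f i) \<longrightarrow>
              (\<forall>w \<in> carrier (free_group d). h' w = h w))"
proof -
  interpret H: group H by (rule H)
  interpret F: group "free_group d" by (rule group_free_group)
  define v where "v = (\<lambda>l::letter. if snd l then f (fst l) else inv f (fst l))"
  define h where "h = (\<lambda>w. foldr (\<lambda>l y. v l \<otimes> y) w \<one>)"
  have v: "v l \<in> carrier H" if "fst l \<in> {1..d}" for l
    using that f by (auto simp: v_def)
  have v_inv: "v (letter_inv l) = inv v l" if "fst l \<in> {1..d}" for l
  proof -
    have "f (fst l) \<in> carrier H" using f that by (rule funcset_mem)
    then show ?thesis by (cases l) (simp add: v_def)
  qed
  have h: "h w \<in> carrier H" if "fst ` set w \<subseteq> {1..d}" for w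
    using that by (induction w) (auto simp: h_def intro!: v)
  have h_push: "h (push l w) = v l \<otimes> h w" if "fst l \<in> {1..d}" "fst ` set w \<subseteq> {1..d}" for l w
  proof (cases w)
    case (Cons m w')
    have "h w' \<in> carrier H" using that Cons by (intro h) auto
    moreover have "h w = v m \<otimes> h w'" by (simp add: h_def Cons)
    moreover have "h (l # w) = v l \<otimes> h w" by (simp add: h_def)
    ultimately show ?thesis
      using Cons v[OF that(1)] v_inv[OF that(1)] by (auto simp flip: H.m_assoc)
  qed (simp add: h_def)
  have h_mult: "h (foldr push u w) = h u \<otimes> h w"
    if "fst ` set u \<subseteq> {1..d}" "fst ` set w \<subseteq> {1..d}" for u w
    using that
  proof (induction u)
    case Nil
    then show ?case using h[of w] by (simp add: h_def)
  next
    case (Cons l u)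
    have "fst ` set (foldr push u w) \<subseteq> {1..d}"
      using order_trans[OF image_mono[OF set_foldr_push[of u w], of fst], of "{1..d}"] Cons.prems
      by (simp add: image_Un)
    moreover have "h (l # u) = v l \<otimes> h u" by (simp add: h_def)
    ultimately show ?case
      using Cons h[of u] h[of w] v[of l] by (simp add: h_push H.m_assoc)
  qed
  have hom: "h \<in> hom (free_group d) H"
    by (rule homI) (auto simp: free_group_def intro!: h h_mult)
  have gen: "h (free_gen i) = f i" if "i \<in> {1..d}" for i
    using funcset_mem[OF f that] by (simp add: h_def v_def free_gen_def)
  have uniq: "h' w = h w"
    if h': "h' \<in> hom (free_group d) H" and g: "\<forall>i\<in>{1..d}. h' (free_gen i) = f i"
      and w: "w \<in> carrier (free_group d)" for h' w
  proof -
    interpret h': group_hom "free_group d" H h'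
      by unfold_locales (rule h')
    have letter: "h' [l] = v l" if "fst l \<in> {1..d}" for l
    proof (cases "snd l")
      case True
      then have "[l] = free_gen (fst l)" by (cases l) (simp add: free_gen_def)
      then show ?thesis using True g that by (simp add: v_def)
    next
      case False
      then have "[l] = inv\<^bsub>free_group d\<^esub> (free_gen (fst l))"
        using inv_free_gen[OF that] by (cases l) simp
      then show ?thesis using False g that h'.hom_inv[OF free_gen_carrier[OF that]]
        by (simp add: v_def)
    qed
    show ?thesis using w
    proof (induction w)
      case Nil
      then show ?case using h'.hom_one by (simp add: h_def free_group_def)
    next
      case (Cons l w)
      have l: "fst l \<in> {1..d}" and red: "reduced (l # w)"
        using Cons.prems by (auto simp: free_group_def)
      have w: "w \<in> carrier (free_group d)" and l': "[l] \<in> carrier (free_group d)"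
        using Cons.prems reduced_tl[OF red] by (auto simp: free_group_def)
      have "l # w = [l] \<otimes>\<^bsub>free_group d\<^esub> w"
        using push_reduced[OF red] by (simp add: free_group_def)
      then have "h' (l # w) = v l \<otimes> h' w"
        using h'.hom_mult[OF l' w] letter[OF l] by simp
      then show ?case using Cons.IH[OF w] by (simp add: h_def)
    qed
  qed
  show ?thesis using hom gen uniq by blast
qed

end

theory Submission
  imports Defs "HOL-Analysis.Convex"
begin

text \<open>
  Write \<open>k = 2 * d - 1\<close>. In the Cayley tree every word other than the root has \<open>k\<close> children, and
  the root has \<open>k + 1\<close>. Join \<open>a\<close> and \<open>b\<close> by an edge when \<open>E b a > 0\<close>. Symmetry of \<open>E\<close> makes
  this an undirected graph, so a point of the shift is a graph homomorphism from the tree; and since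
  no vertex of the graph is isolated, every homomorphism from a ball extends to the tree. The patterns
  on a ball are therefore the homomorphisms from it (\<open>ball_patterns_eq_ball_maps\<close>). Summing out the
  leaves, sphere by sphere, counts them (\<open>card_ball_maps\<close>): with \<open>c\<^sub>0 = 1\<close> and
  \<open>c\<^sub>n\<^sub>+\<^sub>1(a) = (\<Sum>b \<sim> a. c\<^sub>n(b) ^ k)\<close>, their number is \<open>\<Sum>a. c\<^sub>n(a) ^ (k + 1)\<close>.
  
  The heart is a comparison of the recursion for \<open>k\<close> with the one for \<open>K \<ge> k\<close>
  (\<open>branch_count_comparison\<close>). Put \<open>r = k / K\<close>. Then \<open>ln c\<^sub>n\<^sub>+\<^sub>1\<close> for \<open>k\<close> is at most an average of the
  numbers \<open>ln c\<^sub>j\<^sub>+\<^sub>1\<close> for \<open>K\<close>, where \<open>j \<le> n\<close> is distributed as a geometric variable with parameter \<open>r\<close>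
  cut off at \<open>n\<close>. One level of the recursion multiplies a logarithm by \<open>k\<close>, which is \<open>K\<close> with weight \<open>r\<close>
  and \<open>0\<close> with weight \<open>1 - r\<close>; the second alternative restarts the recursion, and Hoelder's inequality
  says that the average passes through the logarithm of the sum over neighbours.
  
  For \<open>K \<ge> 2\<close> the largest value of \<open>ln c\<^sub>n\<close>, divided by \<open>K ^ n\<close>, increases to a finite limit \<open>\<gamma>\<close>
  (\<open>max_count_growth_rate\<close>), and the entropy is \<open>(K - 1) * \<gamma>\<close> (\<open>entropy_rate_eq\<close>). Because the limit is
  approached from below, the bound \<open>ln c\<^sub>j \<le> \<gamma> * K ^ j\<close> holds at every level and can be put into
  the average. The average of \<open>K ^ (j + 1)\<close> is, up to an affine change, the size of the ball in the
  tree for \<open>k\<close>, and the outcome is that the logarithm of the number of patterns for \<open>k\<close> is at most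
  \<open>(K - 1) * \<gamma>\<close> times the size of the ball, plus a constant (\<open>ball_count_comparison\<close>). Division
  by the size gives the theorem (\<open>entropy_rate_mono\<close>). Since \<open>lim\<close> has an arbitrary value on divergent
  sequences, convergence for the smaller \<open>k\<close> is needed as well. The remaining case \<open>k = 1\<close>, where
  \<open>c\<^sub>n\<close> counts walks, follows from log-convexity of walk counts (\<open>walk_count_log_convex\<close>).
\<close>

section \<open>Balls and spheres of the free group\<close>

lemma reduced_snoc:
  "reduced (w @ [l]) \<longleftrightarrow> reduced w \<and> (w = [] \<or> l \<noteq> letter_inv (last w))"
  by (induction w rule: reduced.induct) auto

lemma reduced_take: "reduced w \<Longrightarrow> reduced (take n w)"
proof (induction w rule: rev_induct)
  case (snoc l w)
  then show ?case by (cases "n \<le> length w") (simp_all add: reduced_snoc)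
qed simp

definition words :: "nat \<Rightarrow> letter list set" where
  "words d = {w. reduced w \<and> fst ` set w \<subseteq> {1..d}}"

lemma carrier_free_group: "carrier (free_group d) = words d"
  by (simp add: free_group_def words_def)

lemma mult_free_group: "(\<otimes>\<^bsub>free_group d\<^esub>) = foldr push"
  by (simp add: free_group_def)

lemma one_free_group: "\<one>\<^bsub>free_group d\<^esub> = []"
  by (simp add: free_group_def)

lemma Nil_in_words [simp]: "[] \<in> words d"
  by (simp add: words_def)

lemma words_snocD: "w @ [l] \<in> words d \<Longrightarrow> w \<in> words d \<and> fst l \<in> {1..d}"
  by (auto simp: words_def reduced_snoc)

lemma take_in_words: "w \<in> words d \<Longrightarrow> take n w \<in> words d"
  using set_take_subset[of n w] by (force simp: words_def reduced_take)

text \<open>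
  Right multiplication by a letter is a step along an edge of the tree, away from the root here and
  towards the root in the next lemma.
\<close>

lemma foldr_push_snoc: "w @ [l] \<in> words d \<Longrightarrow> foldr push w [l] = w @ [l]"
  using foldr_push_Nil[of "w @ [l]"] by (simp add: words_def)

lemma foldr_push_snoc_inv:
  "w @ [l] \<in> words d \<Longrightarrow> foldr push (w @ [l]) [letter_inv l] = w"
  using foldr_push_Nil[of w] by (simp add: words_def reduced_snoc)

lemma generators_free_group:
  "free_gen ` {1..d} \<union> (\<lambda>i. inv\<^bsub>free_group d\<^esub> (free_gen i)) ` {1..d} = {[l] | l. fst l \<in> {1..d}}"
proof -
  have "(\<lambda>i. inv\<^bsub>free_group d\<^esub> (free_gen i)) ` {1..d} = (\<lambda>i. [(i, False)]) ` {1..d}"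
    by (intro image_cong) (auto simp: inv_free_gen)
  moreover have "{[l :: letter] | l. fst l \<in> {1..d}}
      = (\<lambda>i. [(i, True)]) ` {1..d} \<union> (\<lambda>i. [(i, False)]) ` {1..d}"
  proof (intro equalityI subsetI)
    fix u :: "letter list" assume "u \<in> {[l] | l. fst l \<in> {1..d}}"
    then obtain i e where "u = [(i, e)]" "i \<in> {1..d}" by auto
    then show "u \<in> (\<lambda>i. [(i, True)]) ` {1..d} \<union> (\<lambda>i. [(i, False)]) ` {1..d}"
      by (cases e) simp_all
  next
    fix u assume "u \<in> (\<lambda>i. [(i, True)]) ` {1..d} \<union> (\<lambda>i. [(i, False)]) ` {1..d}"
    then show "u \<in> {[l] | l. fst l \<in> {1..d}}" by force
  qed
  ultimately show ?thesis by (simp add: free_gen_def)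
qed

lemma length_push_le: "length (push l w) \<le> Suc (length w)"
  by (cases w) auto

lemma word_ball_eq: "word_ball d n = {w \<in> words d. length w \<le> n}"
proof (intro equalityI subsetI)
  fix w assume "w \<in> word_ball d n"
  then obtain us where us: "length us \<le> n" "set us \<subseteq> {[l] | l. fst l \<in> {1..d}}"
      and w: "w = foldr (foldr push) us []"
    unfolding word_ball_def generators_free_group
    by (auto simp: mult_free_group one_free_group)
  have "foldr (foldr push) us [] \<in> words d \<and> length (foldr (foldr push) us []) \<le> length us"
    using us(2)
  proof (induction us)
    case (Cons u us)
    then obtain l where l: "u = [l]" "fst l \<in> {1..d}" by auto
    let ?v = "foldr (foldr push) us []"
    have v: "?v \<in> words d" "length ?v \<le> length us" using Cons by auto
    have "fst ` set (push l ?v) \<subseteq> {1..d}"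
      by (rule order_trans[OF image_mono[OF set_push]]) (use v(1) l(2) in \<open>simp add: words_def\<close>)
    then show ?case
      using v l(1) length_push_le[of l ?v] by (simp add: words_def reduced_push)
  qed simp
  then show "w \<in> {w \<in> words d. length w \<le> n}" using us w by simp
next
  fix w assume w: "w \<in> {w \<in> words d. length w \<le> n}"
  have "foldr (foldr push) (map (\<lambda>l. [l]) w) [] = foldr push w []"
    by (induction w) auto
  also have "\<dots> = w" using w by (simp add: words_def foldr_push_Nil)
  finally have "w = foldr (foldr push) (map (\<lambda>l. [l]) w) []" ..
  moreover have "set (map (\<lambda>l. [l]) w) \<subseteq> {[l] | l. fst l \<in> {1..d}}"
    using w unfolding words_def by fastforce
  moreover have "length (map (\<lambda>l. [l]) w) \<le> n" using w by simp
  ultimately show "w \<in> word_ball d n"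
    unfolding word_ball_def generators_free_group mult_free_group one_free_group by blast
qed

definition sphere :: "nat \<Rightarrow> nat \<Rightarrow> letter list set" where
  "sphere d n = {w \<in> words d. length w = n}"

definition children :: "nat \<Rightarrow> letter list \<Rightarrow> letter set" where
  "children d w = {l. w @ [l] \<in> words d}"

lemma children_eq:
  assumes "w \<in> words d"
  shows "children d w = {1..d} \<times> UNIV - (if w = [] then {} else {letter_inv (last w)})"
  using assms by (auto simp: children_def words_def reduced_snoc)

lemma finite_children: "w \<in> words d \<Longrightarrow> finite (children d w)"
  by (simp add: children_eq)

lemma card_children:
  assumes "w \<in> words d"
  shows "card (children d w) = (if w = [] then 2 * d else 2 * d - 1)"
proof (cases "w = []")
  case False
  then have "fst (last w) \<in> {1..d}"
    using assms last_in_set[of w] unfolding words_def by blast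
  then have "letter_inv (last w) \<in> {1..d} \<times> UNIV"
    by (cases "last w") auto
  then show ?thesis
    using False assms by (simp add: children_eq card_Diff_singleton card_cartesian_product)
qed (simp add: children_eq card_cartesian_product)

lemma sphere_0: "sphere d 0 = {[]}"
  by (auto simp: sphere_def)

lemma sphere_Suc:
  "sphere d (Suc n) = (\<lambda>(w, l). w @ [l]) ` (SIGMA w:sphere d n. children d w)"
proof (intro equalityI subsetI)
  fix w assume w: "w \<in> sphere d (Suc n)"
  then have "w = butlast w @ [last w]" "length (butlast w) = n"
    by (auto simp: sphere_def intro!: append_butlast_last_id[symmetric])
  moreover from this have "butlast w \<in> sphere d n" "last w \<in> children d (butlast w)"
    using w words_snocD[of "butlast w" "last w" d] by (auto simp: sphere_def children_def)
  ultimately show "w \<in> (\<lambda>(w, l). w @ [l]) ` (SIGMA w:sphere d n. children d w)"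
    by (intro image_eqI[of _ _ "(butlast w, last w)"]) auto
qed (auto simp: sphere_def children_def)

lemma finite_sphere: "finite (sphere d n)"
proof (induction n)
  case (Suc n)
  moreover have "finite (children d w)" if "w \<in> sphere d n" for w
    using that by (simp add: sphere_def finite_children)
  ultimately show ?case by (simp add: sphere_Suc)
qed (simp add: sphere_0)

lemma prod_sphere_Suc:
  fixes g :: "letter list \<Rightarrow> 'b :: comm_monoid_mult"
  shows "(\<Prod>w\<in>sphere d (Suc n). g (butlast w))
       = (\<Prod>w\<in>sphere d n. g w ^ (if n = 0 then 2 * d else 2 * d - 1))"
proof -
  have inj: "inj_on (\<lambda>(w, l). w @ [l]) (SIGMA w:sphere d n. children d w)"
    by (auto simp: inj_on_def)
  have "(\<Prod>w\<in>sphere d (Suc n). g (butlast w))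
      = (\<Prod>(w, l)\<in>(SIGMA w:sphere d n. children d w). g w)"
    unfolding sphere_Suc by (subst prod.reindex[OF inj]) (auto intro!: prod.cong)
  also have "\<dots> = (\<Prod>w\<in>sphere d n. \<Prod>l\<in>children d w. g w)"
    by (intro prod.Sigma[symmetric] finite_sphere ballI finite_children) (simp add: sphere_def)
  also have "\<dots> = (\<Prod>w\<in>sphere d n. g w ^ (if n = 0 then 2 * d else 2 * d - 1))"
    by (intro prod.cong refl) (auto simp: sphere_def card_children)
  finally show ?thesis .
qed

lemma card_sphere_Suc: "card (sphere d (Suc n)) = 2 * d * (2 * d - 1) ^ n"
proof -
  have step: "card (sphere d (Suc n)) = card (sphere d n) * (if n = 0 then 2 * d else 2 * d - 1)"
    for n
  proof -
    have inj: "inj_on (\<lambda>(w, l). w @ [l]) (SIGMA w:sphere d n. children d w)"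
      by (auto simp: inj_on_def)
    have "card (sphere d (Suc n)) = (\<Sum>w\<in>sphere d n. card (children d w))"
      unfolding sphere_Suc
      by (subst card_image[OF inj], intro card_SigmaI finite_sphere ballI finite_children)
         (simp add: sphere_def)
    also have "\<dots> = (\<Sum>w\<in>sphere d n. if n = 0 then 2 * d else 2 * d - 1)"
      by (intro sum.cong refl) (auto simp: sphere_def card_children)
    finally show ?thesis by simp
  qed
  show ?thesis
    by (induction n) (simp_all add: step[of 0] sphere_0, simp add: step mult_ac)
qed

lemma word_ball_0: "word_ball d 0 = {[]}"
  by (auto simp: word_ball_eq)

lemma word_ball_Suc: "word_ball d (Suc n) = word_ball d n \<union> sphere d (Suc n)"
  by (auto simp: word_ball_eq sphere_def)

lemma word_ball_sphere_disjoint: "word_ball d n \<inter> sphere d (Suc n) = {}"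
  by (auto simp: word_ball_eq sphere_def)

lemma finite_word_ball: "finite (word_ball d n)"
  by (induction n) (simp_all add: word_ball_0 word_ball_Suc finite_sphere)

lemma card_word_ball: "card (word_ball d n) = 1 + 2 * d * (\<Sum>j<n. (2 * d - 1) ^ j)"
  by (induction n)
     (simp_all add: word_ball_0 word_ball_Suc card_Un_disjoint finite_word_ball finite_sphere
        word_ball_sphere_disjoint card_sphere_Suc algebra_simps)

text \<open>
  Parametrised by \<open>k = 2 * d - 1\<close>, the number of children of a word other than the root, because
  the recursions below depend on \<open>d\<close> only through \<open>k\<close>.
\<close>

definition ball_size :: "nat \<Rightarrow> nat \<Rightarrow> real" where
  "ball_size k n = 1 + (real k + 1) * (\<Sum>j<n. real k ^ j)"

lemma card_word_ball_eq_ball_size: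
  assumes "1 \<le> d"
  shows "real (card (word_ball d n)) = ball_size (2 * d - 1) n"
  using assms by (simp add: card_word_ball ball_size_def of_nat_diff)

lemma ball_size_ge:
  assumes "1 \<le> k" shows "1 + real n \<le> ball_size k n"
proof -
  have "(\<Sum>j<n. 1) \<le> (\<Sum>j<n. real k ^ j)"
    using assms by (intro sum_mono) simp
  then have "1 * real n \<le> (real k + 1) * (\<Sum>j<n. real k ^ j)" by (intro mult_mono) auto
  then show ?thesis by (simp add: ball_size_def)
qed

lemma ball_size_at_top: "1 \<le> k \<Longrightarrow> filterlim (ball_size k) at_top sequentially"
  by (rule filterlim_at_top_mono[OF filterlim_real_sequentially])
     (auto intro!: always_eventually order_trans[OF _ ball_size_ge])

section \<open>Convexity and truncated geometric weights\<close>

text \<open>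
  Hoelder's inequality for finitely many factors, in logarithmic form. After normalising each
  \<open>exp (y i b)\<close> by its sum over \<open>b\<close>, it is Jensen's inequality for \<open>exp\<close> at each \<open>b\<close>, summed over \<open>b\<close>.
\<close>

lemma ln_sum_exp_convex:
  fixes w :: "'i \<Rightarrow> real" and y :: "'i \<Rightarrow> 'b \<Rightarrow> real"
  assumes I: "finite I" "\<And>i. i \<in> I \<Longrightarrow> 0 \<le> w i" "sum w I = 1"
    and B: "finite B" "B \<noteq> {}"
  shows "ln (\<Sum>b\<in>B. exp (\<Sum>i\<in>I. w i * y i b)) \<le> (\<Sum>i\<in>I. w i * ln (\<Sum>b\<in>B. exp (y i b)))"
proof -
  define Z where "Z i = ln (\<Sum>b\<in>B. exp (y i b))" for i
  have pos: "(\<Sum>b\<in>B. exp (f b)) > 0" for f :: "'b \<Rightarrow> real"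
    using B by (intro sum_pos) auto
  have "I \<noteq> {}" using I(3) by auto
  have "(\<Sum>b\<in>B. exp (\<Sum>i\<in>I. w i * y i b)) * exp (- (\<Sum>i\<in>I. w i * Z i))
      = (\<Sum>b\<in>B. exp (\<Sum>i\<in>I. w i *\<^sub>R (y i b - Z i)))"
    by (simp add: sum_distrib_right right_diff_distrib sum_subtractf flip: exp_add)
  also have "\<dots> \<le> (\<Sum>b\<in>B. \<Sum>i\<in>I. w i * exp (y i b - Z i))"
    using I by (intro sum_mono convex_on_sum[OF I(1) \<open>I \<noteq> {}\<close> exp_convex]) auto
  also have "\<dots> = (\<Sum>i\<in>I. w i * ((\<Sum>b\<in>B. exp (y i b)) / exp (Z i)))"
    by (subst sum.swap) (simp add: exp_diff sum_distrib_left sum_divide_distrib)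
  also have "\<dots> = 1"
  proof -
    have "exp (Z i) = (\<Sum>b\<in>B. exp (y i b))" for i using pos[of "y i"] by (simp add: Z_def)
    moreover from this have "(\<Sum>b\<in>B. exp (y i b)) \<noteq> 0" for i by (metis exp_not_eq_zero)
    ultimately show ?thesis using I(3) by simp
  qed
  finally have "(\<Sum>b\<in>B. exp (\<Sum>i\<in>I. w i * y i b)) / exp (\<Sum>i\<in>I. w i * Z i) \<le> 1"
    by (simp only: exp_minus divide_inverse)
  then have "(\<Sum>b\<in>B. exp (\<Sum>i\<in>I. w i * y i b)) \<le> exp (\<Sum>i\<in>I. w i * Z i)"
    by (simp only: divide_le_eq_1_pos exp_gt_zero)
  then have "ln (\<Sum>b\<in>B. exp (\<Sum>i\<in>I. w i * y i b)) \<le> ln (exp (\<Sum>i\<in>I. w i * Z i))"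
    by (rule ln_mono[OF _ pos])
  then show ?thesis by (simp only: ln_exp Z_def)
qed

text \<open>
  The distribution of \<open>min G n\<close>, where \<open>G\<close> takes the value \<open>j\<close> with probability \<open>(1 - r) * r ^ j\<close>.
\<close>

definition geom_weight :: "real \<Rightarrow> nat \<Rightarrow> nat \<Rightarrow> real" where
  "geom_weight r n j = (if j = n then r ^ n else (1 - r) * r ^ j)"

text \<open>
  Conditioning on the first trial: it fails with probability \<open>1 - r\<close>, and otherwise the variable is
  one more than a copy of itself cut off one step earlier.
\<close>

lemma sum_geom_weight_Suc:
  "(\<Sum>j\<le>Suc n. geom_weight r (Suc n) j * f j)
   = (1 - r) * f 0 + r * (\<Sum>j\<le>n. geom_weight r n j * f (Suc j))"
  by (simp add: sum.atMost_Suc_shift sum_distrib_left geom_weight_def if_distrib if_distribR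
        algebra_simps cong: if_cong del: sum.atMost_Suc)

lemma sum_geom_weight: "(\<Sum>j\<le>n. geom_weight r n j) = 1"
proof (induction n)
  case 0
  show ?case by (simp add: geom_weight_def)
next
  case (Suc n)
  then show ?case using sum_geom_weight_Suc[where f = "\<lambda>_. 1" and n = n and r = r] by simp
qed

section \<open>Patterns counted by transfer from the leaves to the root\<close>

locale symmetric_graph =
  fixes A :: "'a set" and nbrs :: "'a \<Rightarrow> 'a set"
  assumes finite_A: "finite A"
    and nbrs_subset: "a \<in> A \<Longrightarrow> nbrs a \<subseteq> A"
    and nbrs_nonempty: "a \<in> A \<Longrightarrow> nbrs a \<noteq> {}"
    and nbrs_sym: "a \<in> A \<Longrightarrow> b \<in> nbrs a \<Longrightarrow> a \<in> nbrs b"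
begin

lemma finite_nbrs: "a \<in> A \<Longrightarrow> finite (nbrs a)"
  using finite_A nbrs_subset finite_subset by blast

definition ball_maps :: "nat \<Rightarrow> nat \<Rightarrow> (letter list \<Rightarrow> 'a) set" where
  "ball_maps d n = {x \<in> word_ball d n \<rightarrow>\<^sub>E A.
     \<forall>w l. w @ [l] \<in> word_ball d n \<longrightarrow> x (w @ [l]) \<in> nbrs (x w)}"

text \<open>
  Homomorphisms from a rooted tree of depth \<open>n\<close> with prescribed label \<open>a\<close> at the root, where the root
  has one child and every other inner vertex has \<open>k\<close> children.
\<close>

fun branch_count :: "nat \<Rightarrow> nat \<Rightarrow> 'a \<Rightarrow> real" where
  "branch_count k 0 a = 1"
| "branch_count k (Suc n) a = (\<Sum>b\<in>nbrs a. branch_count k n b ^ k)"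

lemma ball_maps_in_A: "x \<in> ball_maps d n \<Longrightarrow> w \<in> word_ball d n \<Longrightarrow> x w \<in> A"
  by (auto simp: ball_maps_def)

lemma finite_ball_maps: "finite (ball_maps d n)"
  by (rule finite_subset[of _ "word_ball d n \<rightarrow>\<^sub>E A"])
     (auto simp: ball_maps_def intro!: finite_PiE finite_word_ball finite_A)

lemma butlast_in_ball: "w \<in> sphere d (Suc n) \<Longrightarrow> butlast w \<in> word_ball d n"
  using take_in_words[of w d n] by (auto simp: word_ball_eq sphere_def butlast_conv_take)

lemma snoc_in_sphere:
  "w @ [l] \<in> sphere d (Suc n) \<Longrightarrow> w \<in> word_ball d n"
  using butlast_in_ball[of "w @ [l]"] by simp

text \<open>
  A map on a ball is a map on the ball of radius one less together with a label on each leaf,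
  chosen independently among the neighbours of the label of its parent.
\<close>

lemma sum_ball_maps_Suc:
  fixes F :: "(letter list \<Rightarrow> 'a) \<Rightarrow> (letter list \<Rightarrow> 'a) \<Rightarrow> real"
  shows "(\<Sum>z\<in>ball_maps d (Suc n). F (restrict z (word_ball d n)) (restrict z (sphere d (Suc n))))
    = (\<Sum>x\<in>ball_maps d n. \<Sum>y\<in>(\<Pi>\<^sub>E w\<in>sphere d (Suc n). nbrs (x (butlast w))). F x y)"
proof -
  let ?B = "word_ball d n" and ?S = "sphere d (Suc n)"
  let ?P = "\<lambda>x. \<Pi>\<^sub>E w\<in>?S. nbrs (x (butlast w))"
  let ?join = "\<lambda>(x, y) w. if w \<in> ?B then x w else if w \<in> ?S then y w else undefined"
  have join_snoc: "w @ [l] \<in> ?B \<Longrightarrow> w \<in> ?B" for w l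
    by (auto simp: word_ball_eq dest: words_snocD)
  have disj: "w \<in> ?B \<Longrightarrow> w \<notin> ?S" for w using word_ball_sphere_disjoint by blast
  have "(\<Sum>z\<in>ball_maps d (Suc n). F (restrict z ?B) (restrict z ?S))
      = (\<Sum>(x, y)\<in>(SIGMA x:ball_maps d n. ?P x). F x y)"
  proof (rule sum.reindex_bij_witness[where i = ?join and j = "\<lambda>z. (restrict z ?B, restrict z ?S)"],
      goal_cases)
    case (1 z)
    then show ?case
      by (auto simp: ball_maps_def word_ball_Suc fun_eq_iff PiE_def extensional_def)
  next
    case (2 z)
    have snoc: "z w \<in> nbrs (z (butlast w))" if "w \<in> ?S" for w
    proof -
      have "w = butlast w @ [last w]"
        using that by (auto simp: sphere_def intro!: append_butlast_last_id[symmetric])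
      then show ?thesis using 2 that unfolding ball_maps_def word_ball_Suc
        by (metis (no_types, lifting) UnI2 mem_Collect_eq)
    qed
    show ?case
      using 2 snoc by (auto simp: ball_maps_def word_ball_Suc butlast_in_ball dest: join_snoc)
  next
    case (3 xy)
    then show ?case
      using disj by (fastforce simp: ball_maps_def fun_eq_iff PiE_def extensional_def restrict_def)
  next
    case (4 xy)
    then obtain x y where xy: "xy = (x, y)" "x \<in> ball_maps d n" "y \<in> ?P x" by auto
    have y: "y w \<in> nbrs (x (butlast w))" if "w \<in> ?S" for w using xy that by auto
    have "y w \<in> A" if "w \<in> ?S" for w
      using y[OF that] nbrs_subset[OF ball_maps_in_A[OF xy(2) butlast_in_ball[OF that]]] by auto
    then show ?case
      using xy(1,2) y[of "_ @ [_]"] disj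
      by (auto simp: ball_maps_def word_ball_Suc dest: join_snoc snoc_in_sphere)
  qed auto
  also have "\<dots> = (\<Sum>x\<in>ball_maps d n. \<Sum>y\<in>?P x. F x y)"
    by (intro sum.Sigma[symmetric] finite_ball_maps ballI finite_PiE finite_sphere finite_nbrs)
       (auto intro: ball_maps_in_A butlast_in_ball)
  finally show ?thesis .
qed

text \<open>
  Given the labels of the parents, the leaves are independent, so the sum over their labels
  factorises; siblings contribute equal factors, which gives the power on the right.
\<close>

lemma leaf_transfer:
  "(\<Sum>z\<in>ball_maps d (Suc n). \<Prod>w\<in>sphere d (Suc n). f (z w))
   = (\<Sum>x\<in>ball_maps d n. \<Prod>w\<in>sphere d n.
        (\<Sum>b\<in>nbrs (x w). f b :: real) ^ (if n = 0 then 2 * d else 2 * d - 1))"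
proof -
  have "(\<Sum>z\<in>ball_maps d (Suc n). \<Prod>w\<in>sphere d (Suc n). f (z w))
      = (\<Sum>x\<in>ball_maps d n. \<Sum>y\<in>(\<Pi>\<^sub>E w\<in>sphere d (Suc n). nbrs (x (butlast w))).
          \<Prod>w\<in>sphere d (Suc n). f (y w))"
    by (subst sum_ball_maps_Suc[symmetric]) simp
  also have "\<dots> = (\<Sum>x\<in>ball_maps d n. \<Prod>w\<in>sphere d (Suc n). \<Sum>b\<in>nbrs (x (butlast w)). f b)"
    by (intro sum.cong refl prod_sum_PiE[symmetric] finite_sphere finite_nbrs)
       (auto intro: ball_maps_in_A butlast_in_ball)
  finally show ?thesis
    by (simp add: prod_sphere_Suc[of "\<lambda>w. \<Sum>b\<in>nbrs (_ w). f b"])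
qed

definition ball_count :: "nat \<Rightarrow> nat \<Rightarrow> real" where
  "ball_count k n = (\<Sum>a\<in>A. branch_count k n a ^ (k + 1))"

lemma card_ball_maps:
  assumes "1 \<le> d"
  shows "real (card (ball_maps d n)) = ball_count (2 * d - 1) n"
proof -
  let ?k = "2 * d - 1"
  have root: "(\<Sum>x\<in>ball_maps d 0. f (x [])) = (\<Sum>a\<in>A. f a)" for f :: "'a \<Rightarrow> real"
    by (rule sum.reindex_bij_witness[where i = "\<lambda>a w. if w = [] then a else undefined"
          and j = "\<lambda>x. x []"])
       (auto simp: ball_maps_def word_ball_0 fun_eq_iff PiE_def extensional_def)
  have transfer: "(\<Sum>z\<in>ball_maps d (Suc n). \<Prod>w\<in>sphere d (Suc n). branch_count ?k m (z w) ^ ?k)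
      = (\<Sum>a\<in>A. branch_count ?k (Suc (n + m)) a ^ (2 * d))" for n m
  proof (induction n arbitrary: m)
    case 0
    have "(\<Sum>z\<in>ball_maps d (Suc 0). \<Prod>w\<in>sphere d (Suc 0). branch_count ?k m (z w) ^ ?k)
      = (\<Sum>x\<in>ball_maps d 0. branch_count ?k (Suc m) (x []) ^ (2 * d))"
      by (subst leaf_transfer) (simp add: sphere_0)
    then show ?case using root[of "\<lambda>a. branch_count ?k (Suc m) a ^ (2 * d)"] by simp
  next
    case (Suc n)
    show ?case
      using Suc.IH[of "Suc m"] by (subst leaf_transfer) simp
  qed
  have "real (card (ball_maps d n)) = (\<Sum>a\<in>A. branch_count ?k n a ^ (2 * d))"
  proof (cases n)
    case 0
    then show ?thesis using root[of "\<lambda>_. 1"] by simp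
  next
    case (Suc n')
    then show ?thesis using transfer[where n = n' and m = 0] by simp
  qed
  then show ?thesis using assms by (simp add: ball_count_def)
qed

text \<open>
  The adjacency operator of a symmetric graph is self-adjoint.
\<close>

lemma sum_nbrs_swap:
  "(\<Sum>a\<in>A. f a * (\<Sum>b\<in>nbrs a. g b)) = (\<Sum>b\<in>A. (\<Sum>a\<in>nbrs b. f a) * (g b :: real))"
proof -
  have "(\<Sum>a\<in>A. f a * (\<Sum>b\<in>nbrs a. g b)) = (\<Sum>a\<in>A. \<Sum>b\<in>{b\<in>A. b \<in> nbrs a}. f a * g b)"
    unfolding sum_distrib_left
    using nbrs_subset by (intro sum.cong refl) auto
  also have "\<dots> = (\<Sum>b\<in>A. \<Sum>a\<in>{a\<in>A. b \<in> nbrs a}. f a * g b)"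
    using finite_A by (intro sum.swap_restrict) auto
  also have "\<dots> = (\<Sum>b\<in>A. (\<Sum>a\<in>nbrs b. f a) * g b)"
    unfolding sum_distrib_right
    using nbrs_subset nbrs_sym by (intro sum.cong refl) blast+
  finally show ?thesis .
qed

text \<open>
  For \<open>k = 1\<close> the count of the ball of radius \<open>n\<close> is the squared norm of \<open>M ^ n\<close> applied to the
  constant vector \<open>1\<close>, with \<open>M\<close> the adjacency operator. Moving one factor \<open>M\<close> across the inner
  product and using Cauchy-Schwarz gives log-convexity.
\<close>

lemma walk_count_log_convex: "ball_count 1 (Suc n) ^ 2 \<le> ball_count 1 n * ball_count 1 (Suc (Suc n))"
proof -
  let ?v = "branch_count 1"
  have "ball_count 1 (Suc n) = (\<Sum>a\<in>A. ?v (Suc n) a * (\<Sum>b\<in>nbrs a. ?v n b))"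
    by (simp add: ball_count_def)
  also have "\<dots> = (\<Sum>a\<in>A. ?v (Suc (Suc n)) a * ?v n a)"
    by (subst sum_nbrs_swap) simp
  finally show ?thesis
    using Cauchy_Schwarz_ineq_sum[of "?v (Suc (Suc n))" "?v n" A]
    by (simp add: ball_count_def power2_eq_square mult.commute)
qed

section \<open>Comparing branching numbers\<close>

lemma branch_count_ge_1: "a \<in> A \<Longrightarrow> 1 \<le> branch_count k n a"
proof (induction n arbitrary: a)
  case (Suc n)
  obtain b where b: "b \<in> nbrs a" using nbrs_nonempty[OF Suc.prems] by blast
  have "1 \<le> branch_count k n c ^ k" if "c \<in> nbrs a" for c
    using Suc nbrs_subset[OF Suc.prems] that by (intro one_le_power) blast
  then have "1 \<le> branch_count k n b ^ k" "\<And>c. c \<in> nbrs a \<Longrightarrow> 0 \<le> branch_count k n c ^ k"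
    using b by (force, metis order_trans zero_le_one)
  then show ?case
    using member_le_sum[of b "nbrs a" "\<lambda>c. branch_count k n c ^ k"] b finite_nbrs[OF Suc.prems]
    by fastforce
qed simp

lemma branch_count_pos: "a \<in> A \<Longrightarrow> 0 < branch_count k n a"
  using branch_count_ge_1[of a k n] by simp

lemma ln_branch_count_Suc:
  assumes "a \<in> A"
  shows "ln (branch_count k (Suc n) a) = ln (\<Sum>b\<in>nbrs a. exp (k * ln (branch_count k n b)))"
proof -
  have "branch_count k n b ^ k = exp (k * ln (branch_count k n b))" if "b \<in> nbrs a" for b
    using branch_count_pos[of b k n] nbrs_subset[OF assms] that
    by (auto simp: exp_of_nat_mult)
  then show ?thesis by simp
qed

text \<open>
  In the step, the exponent \<open>k = r * K + (1 - r) * 0\<close> turns the average over depths up to \<open>n\<close> into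
  the one for depths up to \<open>n + 1\<close>, the value \<open>0\<close> being \<open>K\<close> times the logarithm of the count at
  depth zero; Hoelder's inequality then takes the average out of the sum over neighbours.
\<close>

lemma branch_count_comparison:
  assumes "k \<le> K" "0 < K" "a \<in> A"
  shows "ln (branch_count k (Suc n) a)
     \<le> (\<Sum>j\<le>n. geom_weight (k / K) n j * ln (branch_count K (Suc j) a))"
  using assms(3)
proof (induction n arbitrary: a)
  case 0
  then show ?case by (simp add: geom_weight_def)
next
  case (Suc n)
  define r where "r = real k / real K"
  have r: "0 \<le> r" "r \<le> 1" "real k = r * real K" using assms by (auto simp: r_def)
  let ?y = "\<lambda>j b. K * ln (branch_count K j b)"
  have "ln (branch_count k (Suc (Suc n)) a)
      = ln (\<Sum>b\<in>nbrs a. exp (k * ln (branch_count k (Suc n) b)))"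
    using Suc.prems by (rule ln_branch_count_Suc)
  also have "\<dots> \<le> ln (\<Sum>b\<in>nbrs a. exp (\<Sum>j\<le>Suc n. geom_weight r (Suc n) j * ?y j b))"
  proof (intro ln_mono sum_mono sum_pos)
    fix b assume b: "b \<in> nbrs a"
    then have "b \<in> A" using nbrs_subset[OF Suc.prems] by auto
    then have "k * ln (branch_count k (Suc n) b)
        \<le> k * (\<Sum>j\<le>n. geom_weight r n j * ln (branch_count K (Suc j) b))"
      using Suc.IH by (intro mult_left_mono) (auto simp: r_def)
    also have "\<dots> = r * (\<Sum>j\<le>n. geom_weight r n j * ?y (Suc j) b)"
      by (simp add: r(3) sum_distrib_left mult_ac del: branch_count.simps)
    also have "\<dots> = (\<Sum>j\<le>Suc n. geom_weight r (Suc n) j * ?y j b)"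
      by (subst sum_geom_weight_Suc) simp
    finally show "exp (k * ln (branch_count k (Suc n) b))
        \<le> exp (\<Sum>j\<le>Suc n. geom_weight r (Suc n) j * ?y j b)" by simp
  qed (use Suc.prems nbrs_nonempty finite_nbrs in auto)
  also have "\<dots> \<le> (\<Sum>j\<le>Suc n. geom_weight r (Suc n) j * ln (\<Sum>b\<in>nbrs a. exp (?y j b)))"
    using r Suc.prems nbrs_nonempty
    by (intro ln_sum_exp_convex finite_nbrs sum_geom_weight) (auto simp: geom_weight_def)
  also have "\<dots> = (\<Sum>j\<le>Suc n. geom_weight r (Suc n) j * ln (branch_count K (Suc j) a))"
    using Suc.prems by (simp only: ln_branch_count_Suc)
  finally show ?case by (simp only: r_def)
qed

section \<open>Growth of the largest branch count\<close>

definition max_count :: "nat \<Rightarrow> nat \<Rightarrow> real" where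
  "max_count k n = Max (branch_count k n ` A)"

context
  assumes A_nonempty: "A \<noteq> {}"
begin

lemma branch_count_le_max: "a \<in> A \<Longrightarrow> branch_count k n a \<le> max_count k n"
  using finite_A by (simp add: max_count_def)

lemma max_count_attained: obtains a where "a \<in> A" "max_count k n = branch_count k n a"
proof -
  have "max_count k n \<in> branch_count k n ` A"
    unfolding max_count_def using finite_A A_nonempty by (intro Max_in) auto
  then show thesis using that by blast
qed

lemma max_count_ge_1: "1 \<le> max_count k n"
  by (metis max_count_attained branch_count_ge_1)

lemma max_count_0: "max_count k 0 = 1"
  by (metis max_count_attained branch_count.simps(1))

lemma card_A_ge_1: "1 \<le> real (card A)"
  using finite_A A_nonempty by (simp add: Suc_le_eq card_gt_0_iff)

text \<open>
  A neighbour \<open>a\<close> of a maximiser \<open>b\<close> has \<open>b\<close> among its own neighbours, by symmetry, so the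
  term of \<open>b\<close> alone gives the bound.
\<close>

lemma max_count_Suc_ge: "max_count k n ^ k \<le> max_count k (Suc n)"
proof -
  obtain b where b: "b \<in> A" "max_count k n = branch_count k n b" by (rule max_count_attained)
  obtain a where a: "a \<in> nbrs b" using nbrs_nonempty[OF b(1)] by blast
  have aA: "a \<in> A" using a nbrs_subset[OF b(1)] by auto
  have "branch_count k n b ^ k \<le> branch_count k (Suc n) a"
    unfolding branch_count.simps
    using nbrs_sym[OF b(1) a] branch_count_pos nbrs_subset[OF aA]
    by (intro member_le_sum finite_nbrs aA zero_le_power less_imp_le) auto
  then show ?thesis using branch_count_le_max[OF aA] b(2) order_trans by metis
qed

lemma max_count_Suc_le: "max_count k (Suc n) \<le> card A * max_count k n ^ k"
proof -
  obtain a where a: "a \<in> A" "max_count k (Suc n) = branch_count k (Suc n) a"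
    by (rule max_count_attained)
  have "branch_count k (Suc n) a \<le> (\<Sum>b\<in>nbrs a. max_count k n ^ k)"
    unfolding branch_count.simps
    using nbrs_subset[OF a(1)]
    by (intro sum_mono power_mono branch_count_le_max less_imp_le[OF branch_count_pos]) auto
  also have "\<dots> \<le> card A * max_count k n ^ k"
    using card_mono[OF finite_A nbrs_subset[OF a(1)]] max_count_ge_1[of k n]
    by (auto intro!: mult_right_mono)
  finally show ?thesis using a by simp
qed

lemma ln_max_count_Suc_ge: "k * ln (max_count k n) \<le> ln (max_count k (Suc n))"
proof -
  have "ln (max_count k n ^ k) \<le> ln (max_count k (Suc n))"
    using max_count_ge_1[of k n] by (intro ln_mono max_count_Suc_ge) auto
  then show ?thesis using max_count_ge_1[of k n] by (simp add: ln_realpow)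
qed

lemma ln_max_count_Suc_le: "ln (max_count k (Suc n)) \<le> ln (card A) + k * ln (max_count k n)"
proof -
  have p: "max_count k n > 0" "real (card A) > 0"
    using max_count_ge_1[of k n] card_A_ge_1 by linarith+
  have "ln (max_count k (Suc n)) \<le> ln (card A * max_count k n ^ k)"
    using max_count_ge_1[of k "Suc n"] by (intro ln_mono max_count_Suc_le) auto
  then show ?thesis using p by (simp add: ln_mult ln_realpow)
qed

text \<open>
  The second conclusion is what the comparison needs: since the normalised sequence increases to
  its limit, the limit bounds it at every finite level without an error term.
\<close>

lemma max_count_growth_rate:
  assumes K: "2 \<le> K"
  obtains \<gamma> where "(\<lambda>n. ln (max_count K n) / real K ^ n) \<longlonglongrightarrow> \<gamma>"
    and "\<And>n. ln (max_count K n) \<le> \<gamma> * real K ^ n"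
proof -
  define X where "X n = ln (max_count K n) / real K ^ n" for n
  have K0: "real K > 0" using K by simp
  have "incseq X"
  proof (rule incseq_SucI)
    show "X n \<le> X (Suc n)" for n
      using ln_max_count_Suc_ge[of K n] K0 by (simp add: X_def field_simps)
  qed
  \<comment> \<open>The correction \<open>- 1\<close> absorbs the additive term of the recursion because \<open>K \<ge> 2\<close>.\<close>
  have "ln (max_count K n) \<le> ln (card A) * (real K ^ n - 1)" for n
  proof (induction n)
    case 0
    show ?case by (simp add: max_count_0)
  next
    case (Suc n)
    have "ln (max_count K (Suc n)) \<le> ln (card A) + real K * (ln (card A) * (real K ^ n - 1))"
      using ln_max_count_Suc_le[of K n] mult_left_mono[OF Suc, of K] by simp
    also have "\<dots> = ln (card A) * (real K ^ Suc n + 1 - real K)" by (simp add: algebra_simps)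
    also have "\<dots> \<le> ln (card A) * (real K ^ Suc n - 1)"
      using K card_A_ge_1 by (intro mult_left_mono) auto
    finally show ?case .
  qed
  then have "X n \<le> ln (card A)" for n
  proof -
    have "ln (card A) * (real K ^ n - 1) \<le> ln (card A) * real K ^ n"
      using card_A_ge_1 by (intro mult_left_mono) auto
    with \<open>ln (max_count K n) \<le> ln (card A) * (real K ^ n - 1)\<close> show ?thesis
      using K0 by (simp add: X_def field_simps)
  qed
  then obtain \<gamma> where "X \<longlonglongrightarrow> \<gamma>" "\<And>n. X n \<le> \<gamma>"
    using incseq_convergent[OF \<open>incseq X\<close>] by metis
  moreover from this have "ln (max_count K n) \<le> \<gamma> * real K ^ n" for n
    using K0 by (simp add: X_def field_simps)
  ultimately show thesis by (intro that[of \<gamma>]) (simp_all add: X_def[abs_def])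
qed

text \<open>
  The growth bound for \<open>K\<close> inserted into the average over depths. The average of \<open>K ^ (j + 1)\<close>
  satisfies the same affine recursion as \<open>1 + (K - 1) * (\<Sum>j\<le>n. k ^ j)\<close>.
\<close>

lemma max_count_comparison:
  assumes "k \<le> K" "0 < K" and \<gamma>: "\<And>n. ln (max_count K n) \<le> \<gamma> * real K ^ n"
  shows "ln (max_count k n) \<le> \<gamma> * (1 + (real K - 1) * (\<Sum>j<n. real k ^ j))"
proof (cases n)
  case 0
  then show ?thesis using \<gamma>[of 0] by (simp add: max_count_0)
next
  case (Suc m)
  define r where "r = real k / real K"
  have r: "0 \<le> r" "r \<le> 1" "r * real K = real k" using assms by (auto simp: r_def)
  obtain a where a: "a \<in> A" "max_count k n = branch_count k n a" by (rule max_count_attained)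
  have mass: "(\<Sum>j\<le>m. geom_weight r m j * real K ^ Suc j)
      = 1 + (real K - 1) * (\<Sum>j<Suc m. real k ^ j)"
  proof (induction m)
    case 0
    show ?case by (simp add: geom_weight_def)
  next
    case (Suc m)
    have "(\<Sum>j\<le>Suc m. geom_weight r (Suc m) j * real K ^ Suc j)
        = (1 - r) * real K + r * real K * (\<Sum>j\<le>m. geom_weight r m j * real K ^ Suc j)"
      by (subst sum_geom_weight_Suc) (simp add: sum_distrib_left mult_ac)
    also have "\<dots> = real K - real k + real k * (1 + (real K - 1) * (\<Sum>j<Suc m. real k ^ j))"
      by (simp only: Suc r left_diff_distrib mult_1)
    also have "\<dots> = 1 + (real K - 1) * (\<Sum>j<Suc (Suc m). real k ^ j)"
      by (subst (2) sum.lessThan_Suc_shift) (simp add: sum_distrib_left algebra_simps)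
    finally show ?case .
  qed
  have "ln (max_count k n) \<le> (\<Sum>j\<le>m. geom_weight r m j * ln (branch_count K (Suc j) a))"
    using branch_count_comparison[OF assms(1,2) a(1), of m] a(2) Suc
    by (simp add: r_def del: branch_count.simps)
  also have "\<dots> \<le> (\<Sum>j\<le>m. geom_weight r m j * (\<gamma> * real K ^ Suc j))"
  proof (intro sum_mono mult_left_mono)
    fix j
    have "ln (branch_count K (Suc j) a) \<le> ln (max_count K (Suc j))"
      by (intro ln_mono branch_count_pos branch_count_le_max a)
    also have "\<dots> \<le> \<gamma> * real K ^ Suc j" using \<gamma>[of "Suc j"] by simp
    finally show "ln (branch_count K (Suc j) a) \<le> \<gamma> * real K ^ Suc j" .
  qed (use r in \<open>auto simp: geom_weight_def\<close>)
  also have "\<dots> = \<gamma> * (\<Sum>j\<le>m. geom_weight r m j * real K ^ Suc j)"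
    by (simp add: sum_distrib_left mult_ac)
  finally show ?thesis by (simp only: mass Suc)
qed

section \<open>Entropy rates\<close>

lemma ball_count_ge_1: "1 \<le> ball_count k n"
proof -
  obtain a where a: "a \<in> A" using A_nonempty by blast
  have "1 \<le> branch_count k n a ^ (k + 1)" using branch_count_ge_1[OF a] by (rule one_le_power)
  also have "\<dots> \<le> ball_count k n" unfolding ball_count_def
    using a branch_count_pos finite_A by (intro member_le_sum) (auto intro!: less_imp_le)
  finally show ?thesis .
qed

lemma ln_ball_count_ge: "(real k + 1) * ln (max_count k n) \<le> ln (ball_count k n)"
proof -
  obtain a where a: "a \<in> A" "max_count k n = branch_count k n a" by (rule max_count_attained)
  have "branch_count k n a ^ (k + 1) \<le> ball_count k n" unfolding ball_count_def
    using a branch_count_pos finite_A by (intro member_le_sum) (auto intro!: less_imp_le)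
  then have "ln (max_count k n ^ (k + 1)) \<le> ln (ball_count k n)"
    unfolding a(2) using branch_count_pos[OF a(1)] by (intro ln_mono) auto
  then show ?thesis using max_count_ge_1[of k n] by (simp add: ln_realpow algebra_simps del: power_Suc)
qed

lemma ln_ball_count_le: "ln (ball_count k n) \<le> ln (card A) + (real k + 1) * ln (max_count k n)"
proof -
  have "ball_count k n \<le> (\<Sum>a\<in>A. max_count k n ^ (k + 1))" unfolding ball_count_def
    by (intro sum_mono power_mono branch_count_le_max less_imp_le[OF branch_count_pos])
  then have "ln (ball_count k n) \<le> ln (card A * max_count k n ^ (k + 1))"
    using ball_count_ge_1[of k n] by (intro ln_mono) auto
  also have "\<dots> = ln (card A) + (real k + 1) * ln (max_count k n)"
  proof -
    have p: "max_count k n > 0" "real (card A) > 0"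
      using max_count_ge_1[of k n] card_A_ge_1 by linarith+
    then have "ln (card A * max_count k n ^ (k + 1)) = ln (card A) + ln (max_count k n ^ (k + 1))"
      by (intro ln_mult_pos) auto
    then show ?thesis using p by (simp add: ln_realpow algebra_simps del: power_Suc)
  qed
  finally show ?thesis .
qed

text \<open>
  The pattern count lies between \<open>max_count ^ (K + 1)\<close> and \<open>card A\<close> times it, and the size of the
  ball is asymptotic to \<open>(K + 1) / (K - 1) * K ^ n\<close>.
\<close>

lemma entropy_rate_eq:
  assumes K: "2 \<le> K" and \<gamma>: "(\<lambda>n. ln (max_count K n) / real K ^ n) \<longlonglongrightarrow> \<gamma>"
  shows "(\<lambda>n. ln (ball_count K n) / ball_size K n) \<longlonglongrightarrow> (real K - 1) * \<gamma>"
proof -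
  have K1: "real K > 1" using K by simp
  have inv0: "(\<lambda>n. 1 / real K ^ n) \<longlonglongrightarrow> 0"
    using LIMSEQ_inverse_realpow_zero[OF K1] by (simp add: inverse_eq_divide)
  have size: "(\<lambda>n. ball_size K n / real K ^ n) \<longlonglongrightarrow> (real K + 1) / (real K - 1)"
  proof -
    have "ball_size K n / real K ^ n
        = 1 / real K ^ n + (real K + 1) / (real K - 1) * (1 - 1 / real K ^ n)" for n
      using K1 by (simp add: ball_size_def sum_gp_strict field_simps)
    then show ?thesis
      using tendsto_add[OF inv0 tendsto_mult[OF tendsto_const[of "(real K + 1) / (real K - 1)"]
            tendsto_diff[OF tendsto_const[of 1] inv0]]] by simp
  qed
  have "(\<lambda>n. (real K + 1) * ((ln (max_count K n) / real K ^ n) / (ball_size K n / real K ^ n)))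
      \<longlonglongrightarrow> (real K + 1) * (\<gamma> / ((real K + 1) / (real K - 1)))"
    using K1 by (intro tendsto_intros \<gamma> size) auto
  then have low: "(\<lambda>n. (real K + 1) * ln (max_count K n) / ball_size K n) \<longlonglongrightarrow> (real K - 1) * \<gamma>"
    using K1 by (simp add: mult.commute)
  have "(\<lambda>n. ln (card A) / ball_size K n) \<longlonglongrightarrow> 0"
    using K by (intro real_tendsto_divide_at_top[OF tendsto_const] ball_size_at_top) simp
  from tendsto_add[OF this low]
  have up: "(\<lambda>n. (ln (card A) + (real K + 1) * ln (max_count K n)) / ball_size K n)
      \<longlonglongrightarrow> (real K - 1) * \<gamma>" by (simp add: add_divide_distrib)
  have pos: "ball_size K n > 0" for n using ball_size_ge[of K n] K by simp
  show ?thesis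
    by (rule tendsto_sandwich[OF always_eventually always_eventually low up])
       (intro allI divide_right_mono ln_ball_count_ge ln_ball_count_le less_imp_le[OF pos])+
qed

lemma ball_count_comparison:
  assumes "k \<le> K" "0 < K" and \<gamma>: "\<And>n. ln (max_count K n) \<le> \<gamma> * real K ^ n"
  shows "ln (ball_count k n)
    \<le> ln (card A) + \<gamma> * (real k + 2 - real K) + (real K - 1) * \<gamma> * ball_size k n"
proof -
  have "ln (ball_count k n) \<le> ln (card A)
      + (real k + 1) * (\<gamma> * (1 + (real K - 1) * (\<Sum>j<n. real k ^ j)))"
    using ln_ball_count_le[of k n] max_count_comparison[OF assms, of n]
    by (smt (verit) mult_left_mono of_nat_0_le_iff)
  also have "\<dots> = ln (card A) + \<gamma> * (real k + 2 - real K) + (real K - 1) * \<gamma> * ball_size k n"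
    by (simp add: ball_size_def algebra_simps)
  finally show ?thesis .
qed

text \<open>
  For \<open>k \<ge> 2\<close> the limit is the growth rate above. For \<open>k = 1\<close> the logarithm of the count is a convex
  function \<open>f\<close> of the radius, so the slopes of its chords starting at \<open>0\<close> increase; they are bounded,
  and the ball has size \<open>2 * n + 1\<close>.
\<close>

lemma entropy_rate_exists:
  assumes "1 \<le> k"
  shows "convergent (\<lambda>n. ln (ball_count k n) / ball_size k n)"
proof (cases "k = 1")
  case False
  then have "2 \<le> k" using assms by simp
  then show ?thesis
  proof -
    obtain \<gamma> where "(\<lambda>n. ln (max_count k n) / real k ^ n) \<longlonglongrightarrow> \<gamma>"
      by (rule max_count_growth_rate[OF \<open>2 \<le> k\<close>])
    from entropy_rate_eq[OF \<open>2 \<le> k\<close> this] show ?thesis by (rule convergentI)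
  qed
next
  case True
  define f where "f n = ln (ball_count 1 n)" for n
  define q where "q n = (f (Suc n) - f 0) / real (Suc n)" for n
  have pos: "ball_count 1 n > 0" for n using ball_count_ge_1[of 1 n] by linarith
  have convex: "2 * f (Suc n) \<le> f n + f (Suc (Suc n))" for n
  proof -
    have "ln (ball_count 1 (Suc n) ^ 2) \<le> ln (ball_count 1 n * ball_count 1 (Suc (Suc n)))"
      by (intro ln_mono walk_count_log_convex zero_less_power pos)
    then show ?thesis using pos by (simp add: f_def ln_mult_pos ln_realpow)
  qed
  have slope: "f (Suc n) - f 0 \<le> real (Suc n) * (f (Suc (Suc n)) - f (Suc n))" for n
  proof (induction n)
    case 0
    show ?case using convex[of 0] by simp
  next
    case (Suc n)
    have "real (Suc (Suc n)) * (f (Suc (Suc n)) - f (Suc n))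
        \<le> real (Suc (Suc n)) * (f (Suc (Suc (Suc n))) - f (Suc (Suc n)))"
      using convex[of "Suc n"] by (intro mult_left_mono) auto
    then show ?case using Suc by (simp add: algebra_simps)
  qed
  have "incseq q"
  proof (rule incseq_SucI)
    show "q n \<le> q (Suc n)" for n
      using slope[of n] by (simp add: q_def field_simps)
  qed
  moreover have "q n \<le> 2 * ln (card A)" for n
  proof -
    have "ln (max_count 1 n) \<le> n * ln (card A)" for n
    proof (induction n)
      case (Suc n)
      then show ?case using ln_max_count_Suc_le[of 1 n] by (simp add: algebra_simps)
    qed (simp add: max_count_0)
    from this[of "Suc n"]
    have "ln (card A) + 2 * ln (max_count 1 (Suc n)) \<le> ln (card A) + 2 * (real (Suc n) * ln (card A))"
      by linarith
    moreover have "f (Suc n) \<le> ln (card A) + 2 * ln (max_count 1 (Suc n))"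
      using ln_ball_count_le[of 1 "Suc n"] by (simp add: f_def)
    ultimately have "f (Suc n) \<le> ln (card A) + 2 * (real (Suc n) * ln (card A))"
      by linarith
    moreover have "f 0 = ln (card A)" by (simp add: f_def ball_count_def)
    ultimately show ?thesis by (simp add: q_def field_simps)
  qed
  ultimately obtain L where L: "q \<longlonglongrightarrow> L" using incseq_convergent by metis
  have size0: "(\<lambda>n. f 0 / ball_size 1 (Suc n)) \<longlonglongrightarrow> 0"
    using filterlim_compose[OF ball_size_at_top filterlim_Suc, of 1]
    by (intro real_tendsto_divide_at_top[OF tendsto_const]) simp
  have ratio: "(\<lambda>n. real (Suc n) / ball_size 1 (Suc n)) \<longlonglongrightarrow> 1 / 2"
  proof -
    have "(\<lambda>n. 1 / (2 + 1 / real (Suc n))) \<longlonglongrightarrow> 1 / (2 + 0)"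
      by (intro tendsto_intros lim_1_over_n[THEN LIMSEQ_Suc]) simp
    moreover have "real (Suc n) / ball_size 1 (Suc n) = 1 / (2 + 1 / real (Suc n))" for n
      by (simp add: ball_size_def field_simps)
    ultimately show ?thesis by simp
  qed
  have "(\<lambda>n. q n * (real (Suc n) / ball_size 1 (Suc n)) + f 0 / ball_size 1 (Suc n))
      \<longlonglongrightarrow> L * (1 / 2) + 0"
    by (intro tendsto_add tendsto_mult L ratio size0)
  moreover have "q n * (real (Suc n) / ball_size 1 (Suc n)) + f 0 / ball_size 1 (Suc n)
      = f (Suc n) / ball_size 1 (Suc n)" for n
  proof -
    have "q n * real (Suc n) = f (Suc n) - f 0" by (simp add: q_def)
    then show ?thesis by (simp only: times_divide_eq_right flip: add_divide_distrib) simp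
  qed
  ultimately have "(\<lambda>n. f (Suc n) / ball_size 1 (Suc n)) \<longlonglongrightarrow> L * (1 / 2)" by simp
  then have "(\<lambda>n. f n / ball_size 1 n) \<longlonglongrightarrow> L * (1 / 2)" by (rule LIMSEQ_imp_Suc)
  then show ?thesis using True by (auto simp: f_def intro: convergentI)
qed

theorem entropy_rate_mono:
  assumes "1 \<le> k" "k \<le> K"
  shows "lim (\<lambda>n. ln (ball_count k n) / ball_size k n) \<le> lim (\<lambda>n. ln (ball_count K n) / ball_size K n)"
proof (cases "k = K")
  case False
  then have K: "2 \<le> K" using assms by simp
  obtain \<gamma> where lim: "(\<lambda>n. ln (max_count K n) / real K ^ n) \<longlonglongrightarrow> \<gamma>"
    and bound: "\<And>n. ln (max_count K n) \<le> \<gamma> * real K ^ n"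
    by (rule max_count_growth_rate[OF K]) blast
  let ?C = "ln (card A) + \<gamma> * (real k + 2 - real K)"
  have pos: "ball_size k n > 0" for n using ball_size_ge[OF assms(1), of n] by simp
  have "(\<lambda>n. ?C / ball_size k n + (real K - 1) * \<gamma>) \<longlonglongrightarrow> 0 + (real K - 1) * \<gamma>"
    by (intro tendsto_add tendsto_const real_tendsto_divide_at_top[OF tendsto_const]
          ball_size_at_top assms)
  moreover have "ln (ball_count k n) / ball_size k n \<le> ?C / ball_size k n + (real K - 1) * \<gamma>" for n
  proof -
    have "ln (ball_count k n) / ball_size k n
        \<le> (?C + (real K - 1) * \<gamma> * ball_size k n) / ball_size k n"
      using ball_count_comparison[OF assms(2) _ bound, of n] K pos[of n]
      by (intro divide_right_mono) auto
    then show ?thesis using pos[of n] by (simp add: add_divide_distrib)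
  qed
  ultimately have "lim (\<lambda>n. ln (ball_count k n) / ball_size k n) \<le> 0 + (real K - 1) * \<gamma>"
    using entropy_rate_exists[OF assms(1)]
    by (intro LIMSEQ_le[OF convergent_LIMSEQ_iff[THEN iffD1]]) auto
  also have "\<dots> = lim (\<lambda>n. ln (ball_count K n) / ball_size K n)"
    using limI[OF entropy_rate_eq[OF K lim]] by simp
  finally show ?thesis .
qed simp

end

end

section \<open>Markov shifts\<close>

text \<open>
  The Markov condition at \<open>g\<close> and \<open>s\<^sub>i\<close> concerns an edge of the tree that leads away from the root,
  or towards it if \<open>g\<close> ends in the inverse of \<open>s\<^sub>i\<close>. Symmetry of \<open>E\<close> lets every edge be read from
  parent to child.
\<close>

lemma markov_shift_eq:
  fixes A :: "'a set" and E :: "'a \<Rightarrow> 'a \<Rightarrow> real"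
  assumes sym: "\<And>a b. a \<in> A \<Longrightarrow> b \<in> A \<Longrightarrow> E a b = E b a"
  shows "markov_shift d A E = {x \<in> words d \<rightarrow>\<^sub>E A.
    \<forall>w l. w @ [l] \<in> words d \<longrightarrow> x (w @ [l]) \<in> {b \<in> A. E b (x w) > 0}}"
proof (intro equalityI subsetI)
  fix x assume "x \<in> markov_shift d A E"
  then have x: "x \<in> words d \<rightarrow>\<^sub>E A"
    and edge: "\<And>g i. g \<in> words d \<Longrightarrow> i \<in> {1..d} \<Longrightarrow> E (x (foldr push g [(i, True)])) (x g) > 0"
    by (auto simp: markov_shift_def carrier_free_group mult_free_group free_gen_def)
  have "E (x (w @ [l])) (x w) > 0" if wl: "w @ [l] \<in> words d" for w l
  proof -
    have w: "w \<in> words d" "fst l \<in> {1..d}" using words_snocD[OF wl] by auto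
    obtain i e where l: "l = (i, e)" by (cases l)
    show ?thesis
    proof (cases e)
      case True
      then show ?thesis using edge[OF w(1), of i] foldr_push_snoc[OF wl] w l by simp
    next
      case False
      then have "E (x w) (x (w @ [l])) > 0"
        using edge[OF wl, of i] foldr_push_snoc_inv[OF wl] w l by simp
      then show ?thesis using sym[OF PiE_mem[OF x w(1)] PiE_mem[OF x wl]] by simp
    qed
  qed
  then show "x \<in> {x \<in> words d \<rightarrow>\<^sub>E A.
    \<forall>w l. w @ [l] \<in> words d \<longrightarrow> x (w @ [l]) \<in> {b \<in> A. E b (x w) > 0}}"
    using x by auto
next
  fix x assume "x \<in> {x \<in> words d \<rightarrow>\<^sub>E A.
    \<forall>w l. w @ [l] \<in> words d \<longrightarrow> x (w @ [l]) \<in> {b \<in> A. E b (x w) > 0}}"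
  then have x: "x \<in> words d \<rightarrow>\<^sub>E A"
    and edge: "\<And>w l. w @ [l] \<in> words d \<Longrightarrow> E (x (w @ [l])) (x w) > 0" by auto
  have "E (x (foldr push g [(i, True)])) (x g) > 0" if g: "g \<in> words d" and i: "i \<in> {1..d}" for g i
  proof (cases "g @ [(i, True)] \<in> words d")
    case True
    then show ?thesis using edge[OF True] foldr_push_snoc[OF True] by simp
  next
    case False
    then have "g \<noteq> []" "last g = (i, False)"
      using g i by (auto simp: words_def reduced_snoc) (metis letter_inv.simps letter_inv_inv)+
    then obtain w where w: "g = w @ [(i, False)]" by (metis append_butlast_last_id)
    then have "foldr push g [(i, True)] = w"
      using foldr_push_snoc_inv[of w "(i, False)" d] g by simp
    moreover have "E (x g) (x w) > 0" using edge[of w "(i, False)"] g w by simp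
    moreover have "w \<in> words d" using words_snocD[of w] g w by auto
    ultimately show ?thesis using sym[OF PiE_mem[OF x] PiE_mem[OF x g], of w] by simp
  qed
  then show "x \<in> markov_shift d A E"
    using x by (simp add: markov_shift_def carrier_free_group mult_free_group free_gen_def)
qed

text \<open>
  Beyond the ball, labels are continued by following a fixed choice of neighbour, once for each
  further letter.
\<close>

lemma (in symmetric_graph) ball_maps_extend:
  assumes x: "x \<in> ball_maps d n"
  obtains y where "y \<in> words d \<rightarrow>\<^sub>E A" "\<And>w l. w @ [l] \<in> words d \<Longrightarrow> y (w @ [l]) \<in> nbrs (y w)"
    "restrict y (word_ball d n) = x"
proof -
  define nb where "nb a = (SOME b. b \<in> nbrs a)" for a
  have nb: "nb a \<in> nbrs a" if "a \<in> A" for a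
    using nbrs_nonempty[OF that] by (auto simp: nb_def intro: someI_ex)
  define y where "y = restrict (\<lambda>w. (nb ^^ (length w - n)) (x (take n w))) (words d)"
  have iter: "(nb ^^ m) a \<in> A" if "a \<in> A" for m a
    using that by (induction m) (use nb nbrs_subset in auto)
  have base: "x (take n w) \<in> A" if "w \<in> words d" for w
    using ball_maps_in_A[OF x, of "take n w"] take_in_words[OF that] by (simp add: word_ball_eq)
  show thesis
  proof (rule that)
    show "y \<in> words d \<rightarrow>\<^sub>E A" using iter base by (auto simp: y_def)
    show "y (w @ [l]) \<in> nbrs (y w)" if wl: "w @ [l] \<in> words d" for w l
    proof -
      have w: "w \<in> words d" using words_snocD[OF wl] by simp
      show ?thesis
      proof (cases "length w < n")
        case True
        then have "w @ [l] \<in> word_ball d n" using wl by (simp add: word_ball_eq)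
        then have "x (w @ [l]) \<in> nbrs (x w)" using x unfolding ball_maps_def by blast
        then show ?thesis using True w wl by (simp add: y_def)
      next
        case False
        then have "Suc (length w) - n = Suc (length w - n)" by simp
        then show ?thesis using False w wl nb[OF iter[OF base[OF w]]] by (simp add: y_def)
      qed
    qed
    show "restrict y (word_ball d n) = x"
      using x by (auto simp: y_def ball_maps_def word_ball_eq fun_eq_iff PiE_def extensional_def)
  qed
qed

lemma (in symmetric_graph) ball_patterns_eq_ball_maps:
  "ball_patterns d {x \<in> words d \<rightarrow>\<^sub>E A. \<forall>w l. w @ [l] \<in> words d \<longrightarrow> x (w @ [l]) \<in> nbrs (x w)} n
   = ball_maps d n"
  (is "ball_patterns d ?Y n = _")
proof (intro equalityI subsetI)
  fix z assume "z \<in> ball_patterns d ?Y n"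
  then obtain x where x: "x \<in> ?Y" "z = restrict x (word_ball d n)"
    by (auto simp: ball_patterns_def)
  have "w \<in> word_ball d n" if "w @ [l] \<in> word_ball d n" for w l
    using that words_snocD[of w l d] by (simp add: word_ball_eq)
  moreover have "w \<in> words d" if "w \<in> word_ball d n" for w
    using that by (simp add: word_ball_eq)
  ultimately show "z \<in> ball_maps d n"
    using x by (auto simp: ball_maps_def)
next
  fix z assume "z \<in> ball_maps d n"
  then obtain y where "y \<in> ?Y" "restrict y (word_ball d n) = z"
    by (rule ball_maps_extend) blast
  then show "z \<in> ball_patterns d ?Y n" by (auto simp: ball_patterns_def)
qed

text \<open>
  With no letters there are no configurations, and \<open>ln 0 = 0\<close> makes the value the same for every \<open>d\<close>.
\<close>

lemma shift_entropy_empty_alphabet: "shift_entropy d (markov_shift d {} E) = lim (\<lambda>n. 0)"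
proof -
  have "[] \<in> carrier (free_group d)" by (simp add: carrier_free_group)
  then have "markov_shift d {} E = {}" by (auto simp: markov_shift_def)
  then show ?thesis by (simp add: shift_entropy_def ball_patterns_def)
qed

theorem corollary2:
  fixes A :: "'a set" and E :: "'a \<Rightarrow> 'a \<Rightarrow> real"
  assumes "finite A"
    and "\<And>a b. a \<in> A \<Longrightarrow> b \<in> A \<Longrightarrow> E a b \<ge> 0"
    and "\<And>a b. a \<in> A \<Longrightarrow> b \<in> A \<Longrightarrow> E a b = E b a"
    and "\<And>b. b \<in> A \<Longrightarrow> (\<Sum>a\<in>A. E a b) > 0"
    and "\<And>a. a \<in> A \<Longrightarrow> (\<Sum>b\<in>A. E a b) > 0"
  shows "mono_on {1..} (\<lambda>d. shift_entropy d (markov_shift d A E))"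
proof (cases "A = {}")
  case True
  then show ?thesis by (simp add: shift_entropy_empty_alphabet mono_on_def)
next
  case False
  define nbrs where "nbrs a = {b \<in> A. E b a > 0}" for a
  interpret symmetric_graph A nbrs
  proof
    show "nbrs a \<noteq> {}" if "a \<in> A" for a
      using assms(4)[OF that] sum_nonpos[of A "\<lambda>b. E b a"] by (force simp: nbrs_def not_less)
    show "a \<in> nbrs b" if "a \<in> A" "b \<in> nbrs a" for a b
      using that assms(3)[of a b] by (simp add: nbrs_def)
  qed (auto simp: nbrs_def \<open>finite A\<close>)
  have entropy: "shift_entropy d (markov_shift d A E)
      = lim (\<lambda>n. ln (ball_count (2 * d - 1) n) / ball_size (2 * d - 1) n)" if "1 \<le> d" for d
  proof -
    have "markov_shift d A E = {x \<in> words d \<rightarrow>\<^sub>E A.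
        \<forall>w l. w @ [l] \<in> words d \<longrightarrow> x (w @ [l]) \<in> nbrs (x w)}"
      unfolding nbrs_def by (rule markov_shift_eq[OF assms(3)])
    then show ?thesis
      unfolding shift_entropy_def
      by (simp only: ball_patterns_eq_ball_maps card_ball_maps[OF that]
            card_word_ball_eq_ball_size[OF that])
  qed
  show ?thesis
  proof (rule mono_onI)
    fix d d' :: nat assume "d \<in> {1..}" "d' \<in> {1..}" "d \<le> d'"
    then have "1 \<le> d" "1 \<le> d'" "2 * d - 1 \<le> 2 * d' - 1" "1 \<le> 2 * d - 1" by auto
    then show "shift_entropy d (markov_shift d A E) \<le> shift_entropy d' (markov_shift d' A E)"
      using entropy entropy_rate_mono[OF False] by presburger
  qed
qed

end
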